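(* Let $G$ be a group, let $N$ be a normal subgroup of $G$ and let $H$ be a commensurated subgroup of $G$ such that $N \cap H = \{1\}$. Assume that every normal FC-subgroup of $G$ is finite. If $G$ is generated by finitely many cosets of $H$ and if $H$ is relatively residually finite in $G$, then $H$ has a finite index subgroup that commutes with $N$ (i.e. is contained in the centralizer of $N$).
   Context: A subgroup $H$ of a group $G$ is commensurated if $[H : H \cap gHg^{-1}] < \infty$ for all $g \in G$. "$G$ is generated by finitely many cosets of $H$" means that there is a finite subset $Y \subseteq G$ with $G = \langle YH \rangle$. An FC-subgroup of $G$ is a subgroup $L$ in which every element has a finite $L$-conjugacy class. Let $\mathcal{N}(G,H)$ be the set of normal subgroups of $G$ that contain a finite index subgroup of $H$. The subgroup $H$ is relatively residually finite in $G$ if $\bigcap_{M \in \mathcal{N}(G,H)} M = \{1\}$. *)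

theory Defs
  imports "HOL-Algebra.Generated_Groups"
begin

text \<open>Finiteness of an index is expressed by finiteness of the set of cosets, since \<open>card\<close> is 0
  on infinite sets.\<close>

definition finite_index_subgroup :: "('a, 'b) monoid_scheme \<Rightarrow> 'a set \<Rightarrow> 'a set \<Rightarrow> bool" where
  "finite_index_subgroup G K H \<longleftrightarrow>
     subgroup K (G\<lparr>carrier := H\<rparr>) \<and> finite (rcosets\<^bsub>G\<lparr>carrier := H\<rparr>\<^esub> K)"

definition conjugate_set :: "('a, 'b) monoid_scheme \<Rightarrow> 'a \<Rightarrow> 'a set \<Rightarrow> 'a set" where
  "conjugate_set G g H = g <#\<^bsub>G\<^esub> (H #>\<^bsub>G\<^esub> inv\<^bsub>G\<^esub> g)"

definition commensurated :: "('a, 'b) monoid_scheme \<Rightarrow> 'a set \<Rightarrow> bool" where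
  "commensurated G H \<longleftrightarrow>
     subgroup H G \<and>
     (\<forall>g \<in> carrier G. finite_index_subgroup G (H \<inter> conjugate_set G g H) H)"

definition generated_by_finitely_many_cosets :: "('a, 'b) monoid_scheme \<Rightarrow> 'a set \<Rightarrow> bool" where
  "generated_by_finitely_many_cosets G H \<longleftrightarrow>
     (\<exists>Y. finite Y \<and> Y \<subseteq> carrier G \<and> carrier G = generate G (Y <#>\<^bsub>G\<^esub> H))"

definition conjugacy_class :: "('a, 'b) monoid_scheme \<Rightarrow> 'a set \<Rightarrow> 'a \<Rightarrow> 'a set" where
  "conjugacy_class G L x = {l \<otimes>\<^bsub>G\<^esub> x \<otimes>\<^bsub>G\<^esub> inv\<^bsub>G\<^esub> l | l. l \<in> L}"

text \<open>Conjugacy classes are taken with respect to \<open>L\<close> itself, not the ambient group.\<close>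

definition FC_subgroup :: "('a, 'b) monoid_scheme \<Rightarrow> 'a set \<Rightarrow> bool" where
  "FC_subgroup G L \<longleftrightarrow> subgroup L G \<and> (\<forall>x \<in> L. finite (conjugacy_class G L x))"

definition normal_over :: "('a, 'b) monoid_scheme \<Rightarrow> 'a set \<Rightarrow> 'a set set" where
  "normal_over G H = {M. M \<lhd> G \<and> (\<exists>K. finite_index_subgroup G K H \<and> K \<subseteq> M)}"

definition relatively_residually_finite :: "('a, 'b) monoid_scheme \<Rightarrow> 'a set \<Rightarrow> bool" where
  "relatively_residually_finite G H \<longleftrightarrow> \<Inter> (normal_over G H) = {\<one>\<^bsub>G\<^esub>}"

definition centralizer :: "('a, 'b) monoid_scheme \<Rightarrow> 'a set \<Rightarrow> 'a set" where
  "centralizer G N = {g \<in> carrier G. \<forall>n \<in> N. g \<otimes>\<^bsub>G\<^esub> n = n \<otimes>\<^bsub>G\<^esub> g}"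

end

(* Each n in N is centralised by a finite index subgroup of H, since [n, h] lies in the trivial group
   N \<inter> H as soon as n h n^-1 lies in H. The task is to make this uniform in n.
   Let R be the intersection of all M H with M in the family N(G,H). As H is commensurated, for every
   y some M in N(G,H) satisfies y^-1 (M \<inter> R) y \<subseteq> R; as G is generated by finitely many cosets of H, one
   M works for all of them, and then L = M \<inter> R is normal in G. Since the family N(G,H) is directed and
   has trivial intersection, the finite H-class of n in N is also its R-class. Hence N \<inter> L is a normal
   FC-subgroup, so finite, and some M' in N(G,H) meets it trivially. Now N and L \<inter> M' are normal with
   trivial intersection, so they commute, and L \<inter> M' contains a finite index subgroup of H. *)
theory Submission
  imports Defs "HOL-Algebra.Zassenhaus"
begin

context group
begin

section \<open>Finite index as a finite covering by left translates\<close>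

lemma mult_inv_mult_cancel:
  assumes "x \<in> carrier G" "y \<in> carrier G"
  shows "x \<otimes> (inv x \<otimes> y) = y" "inv x \<otimes> (x \<otimes> y) = y"
  using assms by (simp_all flip: m_assoc)

text \<open>The index counts right cosets \<open>K #> a\<close>. Inverting coset representatives
  turns them into left translates, the side needed later, where the factor from \<open>K\<close>
  must stand next to the element acted on.\<close>

lemma finite_index_subgroup_translates:
  assumes "subgroup H G" "finite_index_subgroup G K H"
  obtains T where "finite T" "T \<subseteq> H" "\<And>h. h \<in> H \<Longrightarrow> \<exists>t\<in>T. \<exists>k\<in>K. h = t \<otimes> k"
proof -
  interpret H: subgroup H G by fact
  have K: "subgroup K G" and KH: "K \<subseteq> H"
    using assms(2) incl_subgroup[OF assms(1)] subgroup.subset[of K "G\<lparr>carrier := H\<rparr>"]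
    by (simp_all add: finite_index_subgroup_def)
  interpret K: subgroup K G by fact
  have "rcosets\<^bsub>G\<lparr>carrier := H\<rparr>\<^esub> K = (\<lambda>a. K #> a) ` H"
    by (auto simp: RCOSETS_def r_coset_def)
  then have "finite ((\<lambda>a. K #> a) ` H)"
    using assms(2) by (simp add: finite_index_subgroup_def)
  then obtain T0 where T0: "T0 \<subseteq> H" "finite T0" "(\<lambda>a. K #> a) ` H = (\<lambda>a. K #> a) ` T0"
    using finite_subset_image[of "(\<lambda>a. K #> a) ` H" "\<lambda>a. K #> a" H] by blast
  have "\<exists>t\<in>(\<lambda>a. inv a) ` T0. \<exists>k\<in>K. h = t \<otimes> k" if h: "h \<in> H" for h
  proof -
    have "K #> inv h \<in> (\<lambda>a. K #> a) ` T0" using T0(3) h by blast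
    then obtain a where a: "a \<in> T0" "K #> inv h = K #> a" by blast
    have "inv h \<in> K #> a"
      using a h K repr_independenceD by auto
    then obtain k where k: "k \<in> K" "inv h = k \<otimes> a" by (auto simp: r_coset_def)
    have "h = inv (k \<otimes> a)" using k h by (metis H.mem_carrier inv_inv)
    then have "h = inv a \<otimes> inv k"
      using k a T0(1) by (metis H.mem_carrier K.mem_carrier inv_mult_group subsetD)
    then show ?thesis using a k by blast
  qed
  then show thesis using T0 that[of "(\<lambda>a. inv a) ` T0"] by auto
qed

text \<open>The factor \<open>s\<close> comes from \<open>H\<close> intersected with its conjugate
  by \<open>g\<close>; the conjugate is unfolded so that later arguments can use
  \<open>inv g \<otimes> s \<otimes> g \<in> H\<close> directly.\<close>

lemma commensurated_translates:
  assumes "commensurated G H" "g \<in> carrier G"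
  obtains T where "finite T" "T \<subseteq> H"
    "\<And>h. h \<in> H \<Longrightarrow> \<exists>t\<in>T. \<exists>s\<in>H. inv g \<otimes> s \<otimes> g \<in> H \<and> h = t \<otimes> s"
proof -
  have H: "subgroup H G" and fi: "finite_index_subgroup G (H \<inter> conjugate_set G g H) H"
    using assms by (auto simp: commensurated_def)
  interpret H: subgroup H G by fact
  have conj: "inv g \<otimes> s \<otimes> g \<in> H" if "s \<in> conjugate_set G g H" for s
  proof -
    obtain k where "k \<in> H" "s = g \<otimes> (k \<otimes> inv g)"
      using \<open>s \<in> _\<close> by (auto simp: conjugate_set_def l_coset_def r_coset_def)
    then have "inv g \<otimes> s \<otimes> g = k"
      using assms(2) by (simp add: mult_inv_mult_cancel m_assoc)
    then show ?thesis using \<open>k \<in> H\<close> by simp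
  qed
  show thesis
    using finite_index_subgroup_translates[OF H fi] conj that by (metis Int_iff)
qed

section \<open>The directed family of normal subgroups attached to \<open>H\<close>\<close>

text \<open>A coset of \<open>A \<inter> B\<close> is the intersection of a coset of
  \<open>A\<close> with a coset of \<open>B\<close>, so only finitely many occur.\<close>

lemma finite_index_subgroup_Int:
  assumes "subgroup H G" "finite_index_subgroup G A H" "finite_index_subgroup G B H"
  shows "finite_index_subgroup G (A \<inter> B) H"
proof -
  let ?H = "G\<lparr>carrier := H\<rparr>"
  interpret H: group ?H using assms(1) by (rule subgroup_imp_group)
  have A: "subgroup A ?H" "finite (rcosets\<^bsub>?H\<^esub> A)" and B: "subgroup B ?H" "finite (rcosets\<^bsub>?H\<^esub> B)"
    using assms by (auto simp: finite_index_subgroup_def)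
  have "(A \<inter> B) #>\<^bsub>?H\<^esub> a = (A #>\<^bsub>?H\<^esub> a) \<inter> (B #>\<^bsub>?H\<^esub> a)" if "a \<in> carrier ?H" for a
    using that subgroup.mem_carrier[OF A(1)] subgroup.mem_carrier[OF B(1)] H.right_cancel
    unfolding r_coset_def by blast
  then have "rcosets\<^bsub>?H\<^esub> (A \<inter> B) \<subseteq> (\<lambda>(X, Y). X \<inter> Y) ` ((rcosets\<^bsub>?H\<^esub> A) \<times> (rcosets\<^bsub>?H\<^esub> B))"
    unfolding RCOSETS_def by fastforce
  then have "finite (rcosets\<^bsub>?H\<^esub> (A \<inter> B))"
    using A(2) B(2) by (meson finite_SigmaI finite_imageI finite_subset)
  then show ?thesis
    using A(1) B(1) H.subgroups_Inter_pair by (simp add: finite_index_subgroup_def)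
qed

lemma carrier_in_normal_over:
  assumes "commensurated G H"
  shows "carrier G \<in> normal_over G H"
proof -
  \<comment> \<open>Any finite index subgroup of \<open>H\<close> is a witness; commensuration at
    \<open>\<one>\<close> supplies one.\<close>
  have "finite_index_subgroup G (H \<inter> conjugate_set G \<one> H) H" "H \<subseteq> carrier G"
    using assms subgroup.subset by (auto simp: commensurated_def)
  moreover have "carrier G \<lhd> G" by (simp add: normal_inv_iff subgroup_self)
  ultimately show ?thesis unfolding normal_over_def by blast
qed

lemma normal_over_Int:
  assumes "subgroup H G" "M \<in> normal_over G H" "M' \<in> normal_over G H"
  shows "M \<inter> M' \<in> normal_over G H"
proof -
  obtain K K' where "finite_index_subgroup G K H" "K \<subseteq> M" "finite_index_subgroup G K' H" "K' \<subseteq> M'"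
    using assms by (auto simp: normal_over_def)
  then have "finite_index_subgroup G (K \<inter> K') H" "K \<inter> K' \<subseteq> M \<inter> M'"
    using finite_index_subgroup_Int assms(1) by auto
  then show ?thesis
    using assms normal_subgroup_intersect unfolding normal_over_def by blast
qed

text \<open>Directedness in the form used throughout: finitely many requirements that survive
  shrinking \<open>M\<close> are met together by intersecting their witnesses.\<close>

lemma normal_over_uniform:
  assumes "commensurated G H" "finite I"
    and "\<And>i. i \<in> I \<Longrightarrow> \<exists>M\<in>normal_over G H. P i M"
    and antimono: "\<And>i M M'. \<lbrakk>i \<in> I; P i M; M' \<subseteq> M\<rbrakk> \<Longrightarrow> P i M'"
  shows "\<exists>M\<in>normal_over G H. \<forall>i\<in>I. P i M"
  using assms(2-)
proof (induction I rule: finite_induct)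
  case empty
  then show ?case using carrier_in_normal_over[OF assms(1)] by blast
next
  case (insert i I)
  then obtain M where M: "M \<in> normal_over G H" "\<forall>j\<in>I. P j M" by (metis insertCI)
  obtain M' where M': "M' \<in> normal_over G H" "P i M'" using insert by blast
  have "M \<inter> M' \<in> normal_over G H"
    using M M' assms(1) normal_over_Int by (auto simp: commensurated_def)
  moreover have "\<forall>j\<in>insert i I. P j (M \<inter> M')"
    using M(2) M'(2) insert.prems(2) by (metis Int_lower1 Int_lower2 insert_iff)
  ultimately show ?case by blast
qed

lemma normal_over_avoid:
  assumes "commensurated G H" "relatively_residually_finite G H" "finite S" "\<one> \<notin> S"
  obtains M where "M \<in> normal_over G H" "M \<inter> S = {}"
proof -
  have "\<exists>M\<in>normal_over G H. \<forall>x\<in>S. x \<notin> M"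
    using assms(1,3)
  proof (rule normal_over_uniform)
    show "\<exists>M\<in>normal_over G H. x \<notin> M" if "x \<in> S" for x
    proof -
      have "x \<notin> \<Inter> (normal_over G H)"
        using \<open>x \<in> S\<close> assms(2,4) by (auto simp: relatively_residually_finite_def)
      then show ?thesis by blast
    qed
  qed blast
  then show thesis using that by blast
qed

section \<open>The residual closure of \<open>H\<close> and its conjugates\<close>

text \<open>For commensurated \<open>H\<close>, this is the closure of \<open>H\<close> in the group
  topology whose basic neighbourhoods of \<open>\<one>\<close> are the members of
  \<open>normal_over G H\<close>.\<close>

definition residual_closure :: "'a set \<Rightarrow> 'a set" where
  "residual_closure H = (\<Inter>M\<in>normal_over G H. M <#> H)"

lemma residual_closureD:
  assumes "x \<in> residual_closure H" "M \<in> normal_over G H"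
  obtains m h where "m \<in> M" "h \<in> H" "x = m \<otimes> h"
  using assms by (auto simp: residual_closure_def set_mult_def)

lemma subgroup_residual_closure:
  assumes "commensurated G H"
  shows "subgroup (residual_closure H) G"
  unfolding residual_closure_def
  using assms carrier_in_normal_over[OF assms] mult_norm_subgroup
  by (intro subgroups_Inter) (auto simp: commensurated_def normal_over_def)

lemma subset_residual_closure:
  assumes "commensurated G H"
  shows "H \<subseteq> residual_closure H"
proof -
  have "x \<in> M <#> H" if "x \<in> H" "M \<lhd> G" for x M
  proof -
    have "\<one> \<in> M" "x = \<one> \<otimes> x"
      using that assms subgroup.one_closed[OF normal_imp_subgroup] subgroup.mem_carrier
      by (fastforce simp: commensurated_def)+
    then show ?thesis using that by (auto simp: set_mult_def)
  qed
  then show ?thesis by (auto simp: residual_closure_def normal_over_def)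
qed

text \<open>Modulo the part of \<open>H\<close> that \<open>y\<close> conjugates into
  \<open>H\<close>, only finitely many \<open>t\<close> remain. A single \<open>M\<close> therefore
  excludes every \<open>inv y \<otimes> t \<otimes> y\<close> that lies outside the closure.\<close>

lemma conj_residual_closure:
  assumes com: "commensurated G H" and y: "y \<in> carrier G"
  shows "\<exists>M\<in>normal_over G H. \<forall>x\<in>M \<inter> residual_closure H. inv y \<otimes> x \<otimes> y \<in> residual_closure H"
proof -
  let ?R = "residual_closure H"
  have H: "subgroup H G" using com by (simp add: commensurated_def)
  interpret H: subgroup H G by fact
  interpret R: subgroup ?R G using com by (rule subgroup_residual_closure)
  obtain T where T: "finite T" "T \<subseteq> H"
    "\<And>h. h \<in> H \<Longrightarrow> \<exists>t\<in>T. \<exists>s\<in>H. inv y \<otimes> s \<otimes> y \<in> H \<and> h = t \<otimes> s"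
    using commensurated_translates[OF com y] by blast
  \<comment> \<open>If the conjugate of \<open>t\<close> lies in \<open>?R\<close>, any
    \<open>M\<close> will do; otherwise some \<open>M <#> H\<close> misses it. The implication
    covers both cases and survives shrinking \<open>M\<close>.\<close>
  have "\<exists>M\<in>normal_over G H. \<forall>t\<in>T. inv y \<otimes> t \<otimes> y \<in> M <#> H \<longrightarrow> inv y \<otimes> t \<otimes> y \<in> ?R"
    using com T(1)
  proof (rule normal_over_uniform)
    show "\<exists>M\<in>normal_over G H. inv y \<otimes> t \<otimes> y \<in> M <#> H \<longrightarrow> inv y \<otimes> t \<otimes> y \<in> ?R" for t
      using carrier_in_normal_over[OF com] unfolding residual_closure_def by blast
  qed (auto simp: set_mult_def)
  then obtain M where M: "M \<in> normal_over G H"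
    and MT: "\<And>t. t \<in> T \<Longrightarrow> inv y \<otimes> t \<otimes> y \<in> M <#> H \<Longrightarrow> inv y \<otimes> t \<otimes> y \<in> ?R"
    by blast
  interpret M: normal M G using M by (simp add: normal_over_def)
  have "inv y \<otimes> x \<otimes> y \<in> M' <#> H" if x: "x \<in> M" "x \<in> ?R" and M': "M' \<in> normal_over G H" for x M'
  proof -
    interpret M': normal M' G using M' by (simp add: normal_over_def)
    \<comment> \<open>Factoring through \<open>M \<inter> M'\<close> serves two purposes:
      \<open>M\<close> forces \<open>h \<in> M\<close>, and \<open>M'\<close> will absorb the
      conjugate of \<open>m\<close>.\<close>
    obtain m h where mh: "m \<in> M \<inter> M'" "h \<in> H" "x = m \<otimes> h"
      using residual_closureD[OF x(2) normal_over_Int[OF H M M']] by blast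
    have "h = inv m \<otimes> x" using mh by (simp add: mult_inv_mult_cancel)
    moreover have "inv m \<otimes> x \<in> M" using mh(1) x(1) by simp
    ultimately have hM: "h \<in> M" by simp
    obtain t s where ts: "t \<in> T" "s \<in> H" "inv y \<otimes> s \<otimes> y \<in> H" "h = t \<otimes> s"
      using T(3) mh(2) by blast
    define k where "k = inv y \<otimes> s \<otimes> y"
    have car: "t \<in> carrier G" "s \<in> carrier G" "m \<in> carrier G" "h \<in> carrier G" "k \<in> carrier G"
      using ts T(2) mh y by (auto simp: k_def)
    have hk: "inv y \<otimes> h \<otimes> y = inv y \<otimes> t \<otimes> y \<otimes> k"
      using ts(4) car y by (simp add: k_def m_assoc mult_inv_mult_cancel)
    \<comment> \<open>This puts the conjugate of \<open>t\<close> into \<open>M <#> H\<close>, so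
      the choice of \<open>M\<close> places it in \<open>?R\<close>.\<close>
    have "inv y \<otimes> t \<otimes> y = inv y \<otimes> h \<otimes> y \<otimes> inv k"
      using hk car y by (simp add: m_assoc)
    moreover have "inv y \<otimes> h \<otimes> y \<in> M" using hM y M.inv_op_closed1 by blast
    moreover have "inv k \<in> H" using ts(3) by (simp add: k_def)
    ultimately have "inv y \<otimes> t \<otimes> y \<in> M <#> H" by (auto simp: set_mult_def)
    then have "inv y \<otimes> t \<otimes> y \<in> ?R" using MT ts(1) by blast
    moreover have "k \<in> ?R" using ts(3) subset_residual_closure[OF com] by (auto simp: k_def)
    ultimately have "inv y \<otimes> h \<otimes> y \<in> ?R" using hk by simp
    then obtain m' h' where mh': "m' \<in> M'" "h' \<in> H" "inv y \<otimes> h \<otimes> y = m' \<otimes> h'"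
      using residual_closureD M' by blast
    have "inv y \<otimes> x \<otimes> y = (inv y \<otimes> m \<otimes> y) \<otimes> (inv y \<otimes> h \<otimes> y)"
      using mh(3) car y by (simp add: m_assoc mult_inv_mult_cancel)
    also have "\<dots> = ((inv y \<otimes> m \<otimes> y) \<otimes> m') \<otimes> h'"
      using mh' car y by (simp add: m_assoc)
    finally show ?thesis
      using mh mh' y M'.inv_op_closed1 by (auto simp: set_mult_def)
  qed
  then have "inv y \<otimes> x \<otimes> y \<in> ?R" if "x \<in> M \<inter> ?R" for x
    using that unfolding residual_closure_def[of H] by blast
  then show ?thesis using M by blast
qed

text \<open>Elements of the closure normalise its intersection with any normal \<open>M\<close>, so
  only the finitely many coset representatives and their inverses constrain the choice of
  \<open>M\<close>.\<close>

lemma normal_Int_residual_closure: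
  assumes com: "commensurated G H" and gen: "generated_by_finitely_many_cosets G H"
  obtains M where "M \<in> normal_over G H" "M \<inter> residual_closure H \<lhd> G"
proof -
  let ?R = "residual_closure H"
  have H: "subgroup H G" using com by (simp add: commensurated_def)
  interpret H: subgroup H G by fact
  interpret R: subgroup ?R G using com by (rule subgroup_residual_closure)
  obtain Y where Y: "finite Y" "Y \<subseteq> carrier G" "carrier G = generate G (Y <#> H)"
    using gen by (auto simp: generated_by_finitely_many_cosets_def)
  let ?Z = "Y \<union> (\<lambda>y. inv y) ` Y"
  have Z: "finite ?Z" "?Z \<subseteq> carrier G" using Y(1,2) by auto
  have "\<exists>M\<in>normal_over G H. \<forall>y\<in>?Z. \<forall>x\<in>M \<inter> ?R. inv y \<otimes> x \<otimes> y \<in> ?R"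
    using com Z(1)
  proof (rule normal_over_uniform)
    show "\<exists>M\<in>normal_over G H. \<forall>x\<in>M \<inter> ?R. inv y \<otimes> x \<otimes> y \<in> ?R" if "y \<in> ?Z" for y
      using conj_residual_closure[OF com] that Z(2) by blast
  qed blast
  then obtain M where M: "M \<in> normal_over G H"
    and conj: "\<And>y x. y \<in> ?Z \<Longrightarrow> x \<in> M \<inter> ?R \<Longrightarrow> inv y \<otimes> x \<otimes> y \<in> ?R"
    by blast
  interpret M: normal M G using M by (simp add: normal_over_def)
  let ?L = "M \<inter> ?R"
  have L: "subgroup ?L G"
    using M.subgroup_axioms R.subgroup_axioms subgroups_Inter_pair by blast
  \<comment> \<open>Conjugation is only required to map \<open>?L\<close> into itself, a condition
    closed under products but not evidently under inverses. This is why \<open>?Z\<close> contains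
    the inverses of \<open>Y\<close>.\<close>
  define S where "S = {g \<in> carrier G. \<forall>x\<in>?L. g \<otimes> x \<otimes> inv g \<in> ?L}"
  have S_mult: "a \<otimes> b \<in> S" if "a \<in> S" "b \<in> S" for a b
  proof -
    have "a \<otimes> b \<otimes> x \<otimes> inv (a \<otimes> b) = a \<otimes> (b \<otimes> x \<otimes> inv b) \<otimes> inv a" if "x \<in> ?L" for x
      using that \<open>a \<in> S\<close> \<open>b \<in> S\<close> by (simp add: S_def inv_mult_group m_assoc)
    then show ?thesis using that by (simp add: S_def)
  qed
  have S_R: "h \<in> S" if "h \<in> ?R" for h
    using that M.inv_op_closed2 by (simp add: S_def)
  have S_Y: "y \<in> S \<and> inv y \<in> S" if "y \<in> Y" for y
    using that Y(2) conj[of y] conj[of "inv y"] M.inv_op_closed1[of y] M.inv_op_closed2[of y]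
    by (auto simp: S_def)
  have "g \<in> S" if "g \<in> generate G (Y <#> H)" for g
    using that
  proof (induction rule: generate.induct)
    case one
    show ?case using S_R by simp
  next
    case (incl g)
    then obtain y h where "y \<in> Y" "h \<in> H" "g = y \<otimes> h" by (auto simp: set_mult_def)
    then show ?case using S_mult S_Y S_R subset_residual_closure[OF com] by blast
  next
    case (inv g)
    then obtain y h where yh: "y \<in> Y" "h \<in> H" "g = y \<otimes> h" by (auto simp: set_mult_def)
    then have "inv g = inv h \<otimes> inv y" using Y(2) by (auto simp: inv_mult_group)
    then show ?case using yh S_mult S_Y S_R subset_residual_closure[OF com] H.m_inv_closed by auto
  next
    case (eng a b)
    then show ?case using S_mult by blast
  qed
  then have "?L \<lhd> G" using L Y(3) by (auto simp: normal_inv_iff S_def)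
  then show thesis using that M by blast
qed

section \<open>Commutators and finite conjugacy classes\<close>

lemma commute_if_commutator_trivial:
  assumes "x \<in> carrier G" "y \<in> carrier G" "x \<otimes> y \<otimes> inv x \<otimes> inv y = \<one>"
  shows "x \<otimes> y = y \<otimes> x"
proof -
  have "x \<otimes> y \<otimes> inv x = y"
    using assms inv_equality[of "x \<otimes> y \<otimes> inv x" "inv y"] by simp
  then show ?thesis
    using assms inv_solve_right'[of "x \<otimes> y" y x] by (metis inv_solve_right m_closed)
qed

text \<open>The factor \<open>s\<close> of \<open>h = t \<otimes> s\<close> centralises
  \<open>n\<close>, so the conjugate of \<open>n\<close> by \<open>h\<close> depends only on
  \<open>t\<close>.\<close>

lemma finite_conjugacy_class_of_disjoint_normal:
  assumes "N \<lhd> G" "commensurated G H" "N \<inter> H = {\<one>}" "n \<in> N"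
  shows "finite (conjugacy_class G H n)"
proof -
  interpret N: normal N G by fact
  interpret H: subgroup H G using assms(2) by (simp add: commensurated_def)
  have n: "n \<in> carrier G" using assms(4) by simp
  obtain T where T: "finite T" "T \<subseteq> H"
    "\<And>h. h \<in> H \<Longrightarrow> \<exists>t\<in>T. \<exists>s\<in>H. inv n \<otimes> s \<otimes> n \<in> H \<and> h = t \<otimes> s"
    using commensurated_translates[OF assms(2) n] by blast
  have "h \<otimes> n \<otimes> inv h \<in> (\<lambda>t. t \<otimes> n \<otimes> inv t) ` T" if "h \<in> H" for h
  proof -
    obtain t s where ts: "t \<in> T" "s \<in> H" "inv n \<otimes> s \<otimes> n \<in> H" "h = t \<otimes> s"
      using T(3) \<open>h \<in> H\<close> by blast
    \<comment> \<open>The same commutator is bracketed in two ways, once as a product in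
      \<open>H\<close> and once as a product in \<open>N\<close>.\<close>
    have "inv n \<otimes> s \<otimes> n \<otimes> inv s \<in> H" using ts by simp
    moreover have "inv n \<otimes> (s \<otimes> n \<otimes> inv s) \<in> N" using assms(4) ts N.inv_op_closed2 by simp
    ultimately have "inv n \<otimes> s \<otimes> n \<otimes> inv s = \<one>"
      using assms(3) n ts by (auto simp: m_assoc)
    then have "inv n \<otimes> s = s \<otimes> inv n"
      using commute_if_commutator_trivial[of "inv n" s] n ts by simp
    then have "s \<otimes> n \<otimes> inv s = n"
      using n ts by (metis H.mem_carrier inv_closed inv_solve_left inv_solve_right m_assoc m_closed)
    moreover have "h \<otimes> n \<otimes> inv h = t \<otimes> (s \<otimes> n \<otimes> inv s) \<otimes> inv t"
      using ts T(2) n by (auto simp: inv_mult_group m_assoc subset_iff)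
    ultimately show ?thesis using ts(1) by auto
  qed
  then have "conjugacy_class G H n \<subseteq> (\<lambda>t. t \<otimes> n \<otimes> inv t) ` T"
    by (auto simp: conjugacy_class_def)
  then show ?thesis using T(1) finite_surj by blast
qed

text \<open>A finite set is closed in the residual topology: modulo every \<open>M\<close>,
  conjugating by an element of the closure agrees with conjugating by an element of
  \<open>H\<close>.\<close>

lemma conjugacy_class_residual_closure:
  assumes com: "commensurated G H" and "relatively_residually_finite G H"
    and n: "n \<in> carrier G" and fin: "finite (conjugacy_class G H n)"
  shows "conjugacy_class G (residual_closure H) n \<subseteq> conjugacy_class G H n"
proof
  let ?R = "residual_closure H" and ?C = "conjugacy_class G H n"
  interpret H: subgroup H G using com by (simp add: commensurated_def)
  interpret R: subgroup ?R G using com by (rule subgroup_residual_closure)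
  fix z assume "z \<in> conjugacy_class G ?R n"
  then obtain q where q: "q \<in> ?R" "z = q \<otimes> n \<otimes> inv q" by (auto simp: conjugacy_class_def)
  have z: "z \<in> carrier G" using q n by simp
  have C: "?C \<subseteq> carrier G" using n by (auto simp: conjugacy_class_def)
  show "z \<in> ?C"
  proof (rule ccontr)
    assume "z \<notin> ?C"
    \<comment> \<open>An \<open>M\<close> avoiding these quotients separates \<open>z\<close> from
      all of \<open>?C\<close>, whereas \<open>q = m \<otimes> h\<close> makes \<open>z\<close>
      congruent modulo \<open>M\<close> to the conjugate of \<open>n\<close> by
      \<open>h\<close>.\<close>
    then have "\<one> \<notin> (\<lambda>c. z \<otimes> inv c) ` ?C"
      using z C by (auto simp: subset_iff) (metis inv_closed inv_equality inv_inv)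
    then obtain M where M: "M \<in> normal_over G H" "M \<inter> (\<lambda>c. z \<otimes> inv c) ` ?C = {}"
      using normal_over_avoid[OF assms(1,2)] fin by blast
    interpret M: normal M G using M by (simp add: normal_over_def)
    obtain m h where mh: "m \<in> M" "h \<in> H" "q = m \<otimes> h"
      using residual_closureD q(1) M(1) by blast
    define c where "c = h \<otimes> n \<otimes> inv h"
    have c: "c \<in> ?C" "c \<in> carrier G" using mh n by (auto simp: c_def conjugacy_class_def)
    have "z = m \<otimes> c \<otimes> inv m"
      using q mh n by (simp add: c_def inv_mult_group m_assoc)
    then have "z \<otimes> inv c = m \<otimes> (c \<otimes> inv m \<otimes> inv c)"
      using mh c by (simp add: m_assoc)
    then have "z \<otimes> inv c \<in> M" using mh c M.inv_op_closed2 by simp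
    then show False using M(2) c by blast
  qed
qed

lemma normal_disjoint_commute:
  assumes "A \<lhd> G" "B \<lhd> G" "A \<inter> B \<subseteq> {\<one>}" "a \<in> A" "b \<in> B"
  shows "a \<otimes> b = b \<otimes> a"
proof -
  interpret A: normal A G by fact
  interpret B: normal B G by fact
  have "a \<otimes> b \<otimes> inv a \<otimes> inv b \<in> B" using assms B.inv_op_closed2 by simp
  moreover have "a \<otimes> (b \<otimes> inv a \<otimes> inv b) \<in> A" using assms A.inv_op_closed2 by simp
  ultimately have "a \<otimes> b \<otimes> inv a \<otimes> inv b = \<one>" using assms by (auto simp: m_assoc)
  then show ?thesis
    using commute_if_commutator_trivial[of a b] assms(4,5) A.mem_carrier B.mem_carrier by blast
qed

end

theorem corollary17:
  fixes G :: "('a, 'b) monoid_scheme" and N H :: "'a set"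
  assumes "group G"
    and "N \<lhd> G"
    and "commensurated G H"
    and "N \<inter> H = {\<one>\<^bsub>G\<^esub>}"
    and "\<And>L. L \<lhd> G \<Longrightarrow> FC_subgroup G L \<Longrightarrow> finite L"
    and "generated_by_finitely_many_cosets G H"
    and "relatively_residually_finite G H"
  shows "\<exists>K. finite_index_subgroup G K H \<and> K \<subseteq> centralizer G N"
proof -
  interpret group G by fact
  interpret N: normal N G by fact
  let ?R = "residual_closure H"
  have H: "subgroup H G" using assms(3) by (simp add: commensurated_def)
  obtain M where M: "M \<in> normal_over G H" and L: "M \<inter> ?R \<lhd> G"
    using normal_Int_residual_closure[OF assms(3,6)] by blast
  let ?Q = "N \<inter> (M \<inter> ?R)"
  have Q: "?Q \<lhd> G" using normal_subgroup_intersect[OF assms(2) L] .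
  have "finite (conjugacy_class G ?Q n)" if "n \<in> N" for n
  proof (rule finite_subset)
    show "conjugacy_class G ?Q n \<subseteq> conjugacy_class G ?R n"
      by (auto simp: conjugacy_class_def)
    show "finite (conjugacy_class G ?R n)"
      using finite_conjugacy_class_of_disjoint_normal[OF assms(2-4) that]
        conjugacy_class_residual_closure[OF assms(3,7)] that
      by (meson N.mem_carrier finite_subset)
  qed
  then have "FC_subgroup G ?Q" using Q normal_imp_subgroup by (auto simp: FC_subgroup_def)
  \<comment> \<open>The identity is removed because it lies in every normal subgroup and cannot be
    avoided.\<close>
  then have "finite (?Q - {\<one>\<^bsub>G\<^esub>})" using assms(5) Q by blast
  then obtain M' where M': "M' \<in> normal_over G H" "M' \<inter> (?Q - {\<one>\<^bsub>G\<^esub>}) = {}"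
    using normal_over_avoid[OF assms(3,7)] by blast
  let ?L = "M' \<inter> (M \<inter> ?R)"
  have "?L \<lhd> G" using M'(1) L normal_subgroup_intersect by (auto simp: normal_over_def)
  moreover have "N \<inter> ?L \<subseteq> {\<one>\<^bsub>G\<^esub>}" using M'(2) by blast
  ultimately have comm: "n \<otimes>\<^bsub>G\<^esub> x = x \<otimes>\<^bsub>G\<^esub> n" if "n \<in> N" "x \<in> ?L" for n x
    using normal_disjoint_commute[OF assms(2)] that by blast
  \<comment> \<open>Only \<open>M\<close> and \<open>M'\<close> need to be arranged:
    \<open>K\<close> lies in \<open>H\<close>, hence already in \<open>?R\<close>.\<close>
  obtain K where K: "finite_index_subgroup G K H" "K \<subseteq> M \<inter> M'"
    using normal_over_Int[OF H M M'(1)] by (auto simp: normal_over_def)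
  then have "K \<subseteq> H" using subgroup.subset by (fastforce simp: finite_index_subgroup_def)
  then have "K \<subseteq> ?L" "K \<subseteq> carrier G"
    using K(2) subset_residual_closure[OF assms(3)] subgroup.subset[OF H] by blast+
  then have "K \<subseteq> centralizer G N" using comm by (fastforce simp: centralizer_def)
  then show ?thesis using K(1) by blast
qed

end
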